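(* Let $p$ be a prime. Every extraspecial $p$-group $G$ belongs to the class $\mathcal{C}$, i.e. its Chermak-Delgado measure $m_G$ takes exactly two distinct values on the set of subgroups of $G$.
   Context: For a finite group $G$ and a subgroup $H\leq G$, the Chermak-Delgado measure of $H$ is $m_G(H)=|H|\,|C_G(H)|$, where $C_G(H)$ is the centralizer of $H$ in $G$. It is regarded as a function $m_G$ from the set $L(G)$ of all subgroups of $G$ to the positive integers. $\mathcal{C}$ denotes the class of finite groups $G$ for which the function $m_G$ takes exactly two distinct values. A finite $p$-group $G$ is extraspecial if $Z(G)=G'=\Phi(G)$ has order $p$, where $Z(G)$, $G'$, $\Phi(G)$ are the center, the derived subgroup and the Frattini subgroup of $G$. *)

theory Defs
  imports "HOL-Algebra.Generated_Groups" "HOL-Computational_Algebra.Primes"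
begin

definition centralizer :: "('a, 'b) monoid_scheme \<Rightarrow> 'a set \<Rightarrow> 'a set" where
  "centralizer G H = {g \<in> carrier G. \<forall>h\<in>H. g \<otimes>\<^bsub>G\<^esub> h = h \<otimes>\<^bsub>G\<^esub> g}"

definition center :: "('a, 'b) monoid_scheme \<Rightarrow> 'a set" where
  "center G = {z \<in> carrier G. \<forall>g\<in>carrier G. z \<otimes>\<^bsub>G\<^esub> g = g \<otimes>\<^bsub>G\<^esub> z}"

definition maximal_subgroup :: "'a set \<Rightarrow> ('a, 'b) monoid_scheme \<Rightarrow> bool" where
  "maximal_subgroup M G \<longleftrightarrow> subgroup M G \<and> M \<noteq> carrier G \<and>
     (\<forall>K. subgroup K G \<longrightarrow> M \<subseteq> K \<longrightarrow> K = M \<or> K = carrier G)"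

text \<open>Intersecting with the carrier makes the Frattini subgroup of a group without
  maximal subgroups the whole group, as usual.\<close>

definition frattini :: "('a, 'b) monoid_scheme \<Rightarrow> 'a set" where
  "frattini G = carrier G \<inter> \<Inter> {M. maximal_subgroup M G}"

definition finite_p_group :: "nat \<Rightarrow> ('a, 'b) monoid_scheme \<Rightarrow> bool" where
  "finite_p_group p G \<longleftrightarrow> group G \<and> finite (carrier G) \<and> (\<exists>n. order G = p ^ n)"

definition extraspecial :: "nat \<Rightarrow> ('a, 'b) monoid_scheme \<Rightarrow> bool" where
  "extraspecial p G \<longleftrightarrow> finite_p_group p G \<and>
     center G = derived G (carrier G) \<and> derived G (carrier G) = frattini G \<and>
     card (center G) = p"

definition cd_measure :: "('a, 'b) monoid_scheme \<Rightarrow> 'a set \<Rightarrow> nat" where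
  "cd_measure G H = card H * card (centralizer G H)"

definition in_class_C :: "('a, 'b) monoid_scheme \<Rightarrow> bool" where
  "in_class_C G \<longleftrightarrow> group G \<and> finite (carrier G) \<and>
     card (cd_measure G ` {H. subgroup H G}) = 2"

end

theory Submission
  imports Defs "HOL-Algebra.Zassenhaus"
begin

text \<open>The idea is that the Chermak-Delgado measure of a \<open>p\<close>-group \<open>G\<close> with
  \<open>\<bar>G'\<bar> \<le> p\<close> is monotone. Adjoining one element \<open>x\<close> to a subgroup \<open>K\<close> multiplies its order
  by at least \<open>p\<close>, since orders of subgroups are powers of \<open>p\<close>. It divides the order of the
  centralizer by at most \<open>p\<close>, since the conjugates of \<open>x\<close> lie in the coset \<open>G' x\<close>, so that
  \<open>\<bar>C(K) : C(K) \<inter> C(x)\<bar> \<le> \<bar>G'\<bar>\<close>. Hence \<open>m\<^sub>G(K) \<le> m\<^sub>G(L)\<close> whenever \<open>K \<le> L\<close>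
  (\<open>cd_measure_mono\<close>).

  Both \<open>Z = Z(G)\<close> and \<open>G\<close> have measure \<open>\<bar>Z\<bar> \<bar>G\<bar>\<close>, so monotonicity squeezes the measure of
  every subgroup that contains \<open>Z\<close> to this value, which is \<open>p \<bar>G\<bar>\<close> in the extraspecial case.
  A subgroup \<open>H\<close> that does not contain \<open>Z\<close> meets it trivially because \<open>\<bar>Z\<bar> = p\<close> is prime;
  then \<open>ZH\<close> has order \<open>p \<bar>H\<bar>\<close> and the same centralizer as \<open>H\<close>, so
  \<open>p \<cdot> m\<^sub>G(H) = m\<^sub>G(ZH) = p \<bar>G\<bar>\<close> and \<open>m\<^sub>G(H) = \<bar>G\<bar>\<close>. The trivial subgroup and \<open>G\<close> itself
  attain the two values.\<close>

lemma center_eq_centralizer: "center G = centralizer G (carrier G)"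
  by (simp add: center_def centralizer_def)

lemma centralizer_insert: "centralizer G (insert x K) = centralizer G K \<inter> centralizer G {x}"
  by (auto simp: centralizer_def)

context group
begin

lemma subgroup_centralizer:
  assumes "H \<subseteq> carrier G"
  shows "subgroup (centralizer G H) G"
proof (rule subgroupI)
  show "centralizer G H \<subseteq> carrier G" by (auto simp: centralizer_def)
  show "centralizer G H \<noteq> {}" using assms by (force simp: centralizer_def)
next
  fix a assume a: "a \<in> centralizer G H"
  have "inv a \<otimes> h = h \<otimes> inv a" if "h \<in> H" for h
  proof -
    have h: "h \<in> carrier G" "a \<in> carrier G" "a \<otimes> h = h \<otimes> a"
      using a that assms by (auto simp: centralizer_def)
    have "inv a \<otimes> (a \<otimes> h) \<otimes> inv a = inv a \<otimes> (h \<otimes> a) \<otimes> inv a" using h by simp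
    then show ?thesis using h by (simp add: inv_solve_left inv_solve_right m_assoc)
  qed
  then show "inv a \<in> centralizer G H" using a by (auto simp: centralizer_def)
next
  fix a b assume a: "a \<in> centralizer G H" and b: "b \<in> centralizer G H"
  have "a \<otimes> b \<otimes> h = h \<otimes> (a \<otimes> b)" if "h \<in> H" for h
  proof -
    have "h \<in> carrier G" "a \<in> carrier G" "b \<in> carrier G" "a \<otimes> h = h \<otimes> a" "b \<otimes> h = h \<otimes> b"
      using a b that assms by (auto simp: centralizer_def)
    then show ?thesis by (metis m_assoc)
  qed
  then show "a \<otimes> b \<in> centralizer G H" using a b by (auto simp: centralizer_def)
qed

text \<open>An element \<open>g\<close> centralizes \<open>K\<close> exactly when \<open>K \<subseteq> C(g)\<close>; since \<open>C(g)\<close> is a subgroup, it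
  then contains all of \<open>\<langle>K\<rangle>\<close>.\<close>

lemma centralizer_generate:
  assumes K: "K \<subseteq> carrier G"
  shows "centralizer G (generate G K) = centralizer G K"
proof
  show "centralizer G (generate G K) \<subseteq> centralizer G K"
    using generate.incl[of _ K G] by (auto simp: centralizer_def)
  show "centralizer G K \<subseteq> centralizer G (generate G K)"
  proof
    fix g assume g: "g \<in> centralizer G K"
    then have "g \<in> carrier G" by (simp add: centralizer_def)
    moreover have "K \<subseteq> centralizer G {g}" using g K by (auto simp: centralizer_def)
    then have "generate G K \<subseteq> centralizer G {g}"
      using subgroup_centralizer[of "{g}"] \<open>g \<in> carrier G\<close> by (simp add: generate_subgroup_incl)
    ultimately show "g \<in> centralizer G (generate G K)" by (auto simp: centralizer_def)
  qed
qed

text \<open>The conjugates \<open>g x g\<^sup>-\<^sup>1 = [g,x] x\<close> with \<open>g \<in> A\<close> number at most \<open>\<bar>G'\<bar>\<close>, and by the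
  orbit-stabilizer principle each of them comes from at most \<open>\<bar>A \<inter> C(x)\<bar>\<close> elements of \<open>A\<close>.\<close>

lemma card_le_derived_mult_card_Int_centralizer:
  assumes fin: "finite (carrier G)" and A: "subgroup A G" and x: "x \<in> carrier G"
  shows "card A \<le> card (derived G (carrier G)) * card (A \<inter> centralizer G {x})"
proof -
  let ?comm = "\<lambda>g. g \<otimes> x \<otimes> inv g \<otimes> inv x"
  let ?D = "derived G (carrier G)"
  have AG: "A \<subseteq> carrier G" using A by (rule subgroup.subset)
  have finA: "finite A" using AG fin by (rule finite_subset)
  have D: "?comm ` A \<subseteq> ?D"
    using AG x unfolding derived_def by (auto intro!: generate.incl)
  have "?D \<subseteq> carrier G" by (rule derived_in_carrier) simp
  then have finD: "finite ?D" using fin by (rule finite_subset)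
  have fibre: "card {h \<in> A. ?comm h = c} \<le> card (A \<inter> centralizer G {x})" for c
  proof (cases "{h \<in> A. ?comm h = c} = {}")
    case False
    then obtain g where g: "g \<in> A" "?comm g = c" by blast
    have "{h \<in> A. ?comm h = c} \<subseteq> (\<lambda>y. g \<otimes> y) ` (A \<inter> centralizer G {x})"
    proof
      fix h assume "h \<in> {h \<in> A. ?comm h = c}"
      then have h: "h \<in> A" "?comm h = ?comm g" using g by auto
      have car: "g \<in> carrier G" "h \<in> carrier G" using g h AG by auto
      have "h \<otimes> x \<otimes> inv h = g \<otimes> x \<otimes> inv g" using h(2) car x by simp
      then have "h \<otimes> x \<otimes> inv h \<otimes> h = g \<otimes> x \<otimes> inv g \<otimes> h" by simp
      then have "inv g \<otimes> h \<otimes> x = x \<otimes> (inv g \<otimes> h)" using car x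
        by (simp add: m_assoc inv_solve_left')
      then have "inv g \<otimes> h \<in> A \<inter> centralizer G {x}"
        using g h car A by (simp add: centralizer_def subgroup.m_closed subgroup.m_inv_closed)
      moreover have "h = g \<otimes> (inv g \<otimes> h)" using car by (simp add: m_assoc[symmetric])
      ultimately show "h \<in> (\<lambda>y. g \<otimes> y) ` (A \<inter> centralizer G {x})" by blast
    qed
    then show ?thesis using finA by (meson finite_Int surj_card_le)
  qed (simp only: card.empty le0)
  have "A = (\<Union>c\<in>?D. {h \<in> A. ?comm h = c})" using D by blast
  then have "card A \<le> (\<Sum>c\<in>?D. card {h \<in> A. ?comm h = c})"
    using card_UN_le[OF finD, of "\<lambda>c. {h \<in> A. ?comm h = c}"] by simp
  also have "\<dots> \<le> (\<Sum>c\<in>?D. card (A \<inter> centralizer G {x}))" by (intro sum_mono fibre)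
  finally show ?thesis by simp
qed

lemma card_subgroup_dvd:
  assumes "subgroup H G"
  shows "card H dvd order G"
  using lagrange[OF assms] by (metis dvd_triv_right)

lemma p_group_proper_subgroup_card:
  assumes p: "Factorial_Ring.prime p" and G: "finite (carrier G)" "order G = p ^ n"
    and K: "subgroup K G" and L: "subgroup L G" and KL: "K \<subset> L"
  shows "p * card K \<le> card L"
proof -
  obtain a where a: "card K = p ^ a"
    using card_subgroup_dvd[OF K] p G(2) by (auto simp: divides_primepow_nat)
  obtain b where b: "card L = p ^ b"
    using card_subgroup_dvd[OF L] p G(2) by (auto simp: divides_primepow_nat)
  have "finite L" using subgroup.subset[OF L] G(1) by (rule finite_subset)
  then have "p ^ a < p ^ b" using psubset_card_mono KL a b by metis
  then have "Suc a \<le> b" using prime_gt_1_nat[OF p] by simp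
  then have "p ^ Suc a \<le> p ^ b" using prime_gt_0_nat[OF p] by (intro power_increasing) auto
  then show ?thesis using a b by simp
qed

text \<open>One element at a time, the gain of a factor of at least \<open>p\<close> in the order of the subgroup
  outweighs the loss of a factor of at most \<open>\<bar>G'\<bar> \<le> p\<close> in the order of its centralizer.\<close>

lemma cd_measure_mono:
  assumes p: "Factorial_Ring.prime p" and fin: "finite (carrier G)" and ord: "order G = p ^ n"
    and der: "card (derived G (carrier G)) \<le> p"
    and K: "subgroup K G" and L: "subgroup L G" and KL: "K \<subseteq> L"
  shows "cd_measure G K \<le> cd_measure G L"
  using K KL
proof (induction "card L - card K" arbitrary: K rule: less_induct)
  case (less K)
  show ?case
  proof (cases "K = L")
    case False
    then obtain x where x: "x \<in> L" "x \<notin> K" using less.prems by blast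
    have LG: "L \<subseteq> carrier G" using L by (rule subgroup.subset)
    have finL: "finite L" using LG fin by (rule finite_subset)
    define M where "M = generate G (insert x K)"
    have sub: "insert x K \<subseteq> L" using x less.prems by blast
    have M: "subgroup M G" unfolding M_def using sub LG by (intro generate_is_subgroup) blast
    have M_L: "M \<subseteq> L" unfolding M_def by (rule generate_subgroup_incl[OF sub L])
    have "insert x K \<subseteq> M" unfolding M_def by (intro subsetI generate.incl)
    then have KM: "K \<subset> M" using x by blast
    have "card M \<le> card L" using finL M_L by (rule card_mono)
    moreover have "card K < card M" using finite_subset[OF M_L finL] KM by (rule psubset_card_mono)
    ultimately have "cd_measure G M \<le> cd_measure G L" by (intro less.hyps M M_L) simp
    moreover have "cd_measure G K \<le> cd_measure G M"
    proof -
      have C: "subgroup (centralizer G K) G" and xG: "x \<in> carrier G"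
        using subgroup_centralizer sub LG by blast+
      have "card (centralizer G K)
          \<le> card (derived G (carrier G)) * card (centralizer G K \<inter> centralizer G {x})"
        by (rule card_le_derived_mult_card_Int_centralizer[OF fin C xG])
      also have "centralizer G K \<inter> centralizer G {x} = centralizer G M"
        unfolding M_def using centralizer_generate[of "insert x K"] centralizer_insert[of G x K] sub LG
        by (metis order_trans)
      also have "card (derived G (carrier G)) * card (centralizer G M)
          \<le> p * card (centralizer G M)"
        using der by simp
      finally have "card K * card (centralizer G K) \<le> (p * card K) * card (centralizer G M)"
        by (simp add: mult.left_commute[of p] mult.assoc)
      also have "\<dots> \<le> card M * card (centralizer G M)"
        using p_group_proper_subgroup_card[OF p fin ord less.prems(1) M KM] by simp
      finally show ?thesis by (simp add: cd_measure_def)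
    qed
    ultimately show ?thesis by simp
  qed simp
qed

lemma cd_measure_carrier: "cd_measure G (carrier G) = order G * card (center G)"
  by (simp add: cd_measure_def center_eq_centralizer order_def)

lemma cd_measure_center: "cd_measure G (center G) = order G * card (center G)"
proof -
  have "centralizer G (center G) = carrier G"
    by (auto simp: centralizer_def center_def)
  then show ?thesis by (simp add: cd_measure_def order_def)
qed

lemma cd_measure_one: "cd_measure G {\<one>} = order G"
proof -
  have "centralizer G {\<one>} = carrier G" by (auto simp: centralizer_def)
  then show ?thesis by (simp add: cd_measure_def order_def)
qed

lemma normal_center: "center G \<lhd> G"
proof (rule normal_invI)
  show "subgroup (center G) G"
    by (simp add: center_eq_centralizer subgroup_centralizer)
  fix x h assume x: "x \<in> carrier G" and h: "h \<in> center G"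
  then have "h \<in> carrier G" "x \<otimes> h = h \<otimes> x" by (simp_all add: center_def)
  then have "x \<otimes> h \<otimes> inv x = h" using x by (simp add: m_assoc)
  then show "x \<otimes> h \<otimes> inv x \<in> center G" using h by simp
qed

text \<open>Everything that centralizes \<open>H\<close> also centralizes \<open>Z(G)\<close>, so passing from \<open>H\<close> to \<open>Z(G) H\<close>
  leaves the centralizer unchanged; only the order grows, by the full factor \<open>\<bar>Z(G)\<bar>\<close> because
  the products \<open>z h\<close> are pairwise distinct when \<open>Z(G)\<close> and \<open>H\<close> meet trivially.\<close>

lemma cd_measure_center_mult:
  assumes fin: "finite (carrier G)" and H: "subgroup H G" and triv: "center G \<inter> H = {\<one>}"
  shows "cd_measure G (center G <#> H) = card (center G) * cd_measure G H"
proof -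
  let ?Z = "center G"
  have Z: "subgroup ?Z G" using normal_center by (rule normal_imp_subgroup)
  have ZG: "?Z \<subseteq> carrier G" and HG: "H \<subseteq> carrier G"
    using Z H by (auto dest: subgroup.subset)
  have inj: "inj_on (\<lambda>(z, h). z \<otimes> h) (?Z \<times> H)"
  proof (rule inj_onI, clarify)
    fix z h z' h' assume zh: "z \<in> ?Z" "h \<in> H" "z' \<in> ?Z" "h' \<in> H" and eq: "z \<otimes> h = z' \<otimes> h'"
    have car: "z \<in> carrier G" "h \<in> carrier G" "z' \<in> carrier G" "h' \<in> carrier G"
      using zh ZG HG by auto
    have "z \<otimes> h \<otimes> inv h = z' \<otimes> h' \<otimes> inv h" using eq by simp
    then have q: "inv z' \<otimes> z = h' \<otimes> inv h" using car by (simp add: m_assoc inv_solve_left')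
    have "inv z' \<otimes> z \<in> ?Z" using zh Z by (simp add: subgroup.m_closed subgroup.m_inv_closed)
    moreover have "h' \<otimes> inv h \<in> H" using zh H by (simp add: subgroup.m_closed subgroup.m_inv_closed)
    ultimately have "inv z' \<otimes> z = \<one>" "h' \<otimes> inv h = \<one>" using triv q by auto
    then show "z = z' \<and> h = h'" using car by (simp add: inv_solve_left' inv_solve_right')
  qed
  have "?Z <#> H = (\<lambda>(z, h). z \<otimes> h) ` (?Z \<times> H)" by (auto simp: set_mult_def)
  then have "card (?Z <#> H) = card ?Z * card H"
    using card_image[OF inj] by (simp add: card_cartesian_product)
  moreover have "centralizer G (?Z <#> H) = centralizer G H"
  proof
    have "H \<subseteq> ?Z <#> H"
      using HG subgroup.one_closed[OF Z] by (force simp: set_mult_def)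
    then show "centralizer G (?Z <#> H) \<subseteq> centralizer G H" by (auto simp: centralizer_def)
    show "centralizer G H \<subseteq> centralizer G (?Z <#> H)"
    proof
      fix g assume g: "g \<in> centralizer G H"
      then have gG: "g \<in> carrier G" by (simp add: centralizer_def)
      have "?Z \<subseteq> centralizer G {g}" "H \<subseteq> centralizer G {g}"
        using g gG HG by (auto simp: centralizer_def center_def)
      then have "?Z <#> H \<subseteq> centralizer G {g}"
        using subgroup_centralizer[of "{g}"] gG
        by (auto simp: set_mult_def intro!: subgroup.m_closed)
      then show "g \<in> centralizer G (?Z <#> H)" using gG by (auto simp: centralizer_def)
    qed
  qed
  ultimately show ?thesis by (simp add: cd_measure_def)
qed

lemma prime_card_subgroup_Int_trivial:
  assumes p: "Factorial_Ring.prime (card Z)" and Z: "subgroup Z G" and H: "subgroup H G"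
    and nsub: "\<not> Z \<subseteq> H"
  shows "Z \<inter> H = {\<one>}"
proof -
  have finZ: "finite Z" using p by (metis card.infinite not_prime_0)
  interpret Z: group "G\<lparr>carrier := Z\<rparr>" using Z by (rule subgroup_imp_group)
  have "subgroup (Z \<inter> H) (G\<lparr>carrier := Z\<rparr>)"
    using Z H by (intro subgroup_incl subgroups_Inter_pair) auto
  then have "card (Z \<inter> H) dvd card Z" using Z.card_subgroup_dvd by (simp add: order_def)
  moreover have "card (Z \<inter> H) \<noteq> card Z"
    using nsub finZ by (metis Int_lower1 card_subset_eq inf.absorb_iff1)
  ultimately have "card (Z \<inter> H) = 1" using p prime_nat_iff by blast
  moreover have "\<one> \<in> Z \<inter> H" using Z H by (simp add: subgroup.one_closed)
  ultimately show ?thesis by (metis card_1_singletonE singletonD)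
qed

end

theorem theorem2p5:
  fixes G :: "('a, 'b) monoid_scheme" and p :: nat
  assumes "Factorial_Ring.prime p"
    and "extraspecial p G"
  shows "in_class_C G"
proof -
  have "group G" and fin: "finite (carrier G)"
    and cardZ: "card (center G) = p" and der: "derived G (carrier G) = center G"
    using assms(2) by (auto simp: extraspecial_def finite_p_group_def)
  obtain n where ord: "order G = p ^ n"
    using assms(2) by (auto simp: extraspecial_def finite_p_group_def)
  interpret group G by fact
  have Z: "subgroup (center G) G" using normal_center by (rule normal_imp_subgroup)
  have mono: "cd_measure G K \<le> cd_measure G L" if "subgroup K G" "subgroup L G" "K \<subseteq> L" for K L
    using that der cardZ by (intro cd_measure_mono[OF assms(1) fin ord]) auto
  have above: "cd_measure G H = order G * p" if H: "subgroup H G" "center G \<subseteq> H" for H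
    using mono[OF Z H] mono[OF H(1) subgroup_self subgroup.subset[OF H(1)]]
    by (simp add: cd_measure_center cd_measure_carrier cardZ)
  have notabove: "cd_measure G H = order G" if H: "subgroup H G" "\<not> center G \<subseteq> H" for H
  proof -
    have triv: "center G \<inter> H = {\<one>\<^bsub>G\<^esub>}"
      using assms(1) cardZ H by (intro prime_card_subgroup_Int_trivial Z) auto
    have "center G \<subseteq> center G <#>\<^bsub>G\<^esub> H"
      using subgroup.one_closed[OF H(1)] subgroup.subset[OF Z] by (force simp: set_mult_def)
    then have "order G * p = cd_measure G (center G <#>\<^bsub>G\<^esub> H)"
      using above mult_norm_subgroup[OF normal_center H(1)] by simp
    also have "\<dots> = p * cd_measure G H"
      using cd_measure_center_mult[OF fin H(1) triv] cardZ by simp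
    finally show ?thesis using prime_gt_0_nat[OF assms(1)] by simp
  qed
  have "cd_measure G ` {H. subgroup H G} = {order G, order G * p}"
  proof
    show "cd_measure G ` {H. subgroup H G} \<subseteq> {order G, order G * p}"
      using above notabove by blast
    have "order G = cd_measure G {\<one>\<^bsub>G\<^esub>}" "order G * p = cd_measure G (carrier G)"
      by (simp_all add: cd_measure_one cd_measure_carrier cardZ)
    then show "{order G, order G * p} \<subseteq> cd_measure G ` {H. subgroup H G}"
      using triv_subgroup subgroup_self by blast
  qed
  moreover have "order G \<noteq> order G * p"
    using prime_gt_1_nat[OF assms(1)] order_gt_0_iff_finite fin by simp
  ultimately show ?thesis using \<open>group G\<close> fin by (simp add: in_class_C_def)
qed

end
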